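(* For every integer $n\ge0$, $$(\mathfrak{B}(x))_n=\frac{(x-1)_{n+1}}{n+1}\bigl(\psi(x+n)-\psi(x-1)\bigr).$$ The limit case $x\to1$ of this formula is $\frac{n!}{n+1}$, which recovers Nörlund's evaluation $(\mathfrak{B}+1)_n=\frac{n!}{n+1}$.
   Context: $(a)_n=\frac{\Gamma(a+n)}{\Gamma(a)}=a(a+1)\cdots(a+n-1)$ (with $(a)_0=1$) is the Pochhammer symbol (rising factorial), and $\psi=\Gamma'/\Gamma$ is the digamma function. The Bernoulli umbra $\mathfrak{B}(x)$ is defined by its generating function $\exp(z\mathfrak{B}(x))=\frac{ze^{zx}}{e^z-1}$, so that $\mathfrak{B}(x)^k=B_k(x)$, the Bernoulli polynomial of degree $k$; thus if $(u)_n=\sum_k c_k u^k$, then $(\mathfrak{B}(x))_n=\sum_k c_k B_k(x)$. Equivalently $(\mathfrak{B}(x))_n=E\,(x-\frac12+\imath L_B)_n$, where $\imath$ is the imaginary unit, $E$ denotes expectation and $L_B$ is a real random variable with density $\frac{\pi}{2}\operatorname{sech}^2(\pi u)$, $u\in\mathbb{R}$. The umbra $\mathfrak{B}=\mathfrak{B}(0)$ is the Bernoulli umbra with $\mathfrak{B}^k=B_k$, the Bernoulli numbers (with $B_1=-\frac12$). *)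

theory Defs
  imports
    "HOL-Analysis.Gamma_Function"
    "HOL-Computational_Algebra.Polynomial"
    "HOL-Computational_Algebra.Formal_Power_Series"
begin

text \<open>
  Exponential generating function \<open>z * e^(z x) / (e^z - 1)\<close> as a formal power series in \<open>z\<close>.
  The divisor has subdegree 1, and so has the dividend, so \<open>div\<close> is the exact quotient.
\<close>

definition bernoulli_egf :: "'a::field_char_0 \<Rightarrow> 'a fps" where
  "bernoulli_egf x = (fps_X * fps_exp x) div (fps_exp 1 - 1)"

definition bernoulli_poly :: "nat \<Rightarrow> 'a::field_char_0 \<Rightarrow> 'a" where
  "bernoulli_poly k x = fact k * fps_nth (bernoulli_egf x) k"

text \<open>
  Umbral evaluation \<open>p(\<BB>(x))\<close>: the linear functional on polynomials in an indeterminate \<open>u\<close>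
  with \<open>u^k \<mapsto> B\<^sub>k(x)\<close>.
\<close>

definition bernoulli_umbra :: "'a::field_char_0 \<Rightarrow> 'a poly \<Rightarrow> 'a" where
  "bernoulli_umbra x p = (\<Sum>k\<le>degree p. coeff p k * bernoulli_poly k x)"

end

theory Submission imports Defs begin

text \<open>
  Multiplying the generating function by \<open>e^z - 1\<close> shows that the umbra sends a forward
  difference to a derivative: \<open>p(\<BB>(x) + 1) - p(\<BB>(x)) = p'(x)\<close> for every polynomial \<open>p\<close>
  (\<open>bernoulli_umbra_difference\<close>). The polynomial \<open>p(u) = (u - 1)\<^sub>n\<^sub>+\<^sub>1 / (n + 1)\<close> has
  forward difference \<open>(u)\<^sub>n\<close>, so \<open>(\<BB>(x))\<^sub>n\<close> is its derivative at \<open>x\<close>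
  (\<open>bernoulli_umbra_pochhammer\<close>). The logarithmic derivative of \<open>(x - 1)\<^sub>n\<^sub>+\<^sub>1\<close> is
  \<open>\<psi>(x + n) - \<psi>(x - 1)\<close> by the recurrence of the digamma function, which is the formula.
  At \<open>x = 1\<close> the factor \<open>x - 1\<close> vanishes, so the product rule leaves
  \<open>(1)\<^sub>n / (n + 1) = n! / (n + 1)\<close>; the limit follows by continuity of the derivative, which is
  a polynomial. The evaluation of \<open>(\<BB> + 1)\<^sub>n\<close> is the same computation with \<open>u\<close> shifted by 1.
\<close>

lemma bernoulli_egf_mult:
  "bernoulli_egf (x::'a::field_char_0) * (fps_exp 1 - 1) = fps_X * fps_exp x"
proof -
  have nz: "fps_nth (fps_exp 1 - 1 :: 'a fps) 1 \<noteq> 0"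
    by simp
  have "subdegree (fps_exp 1 - 1 :: 'a fps) = 1"
    by (rule subdegreeI) (use nz in auto)
  moreover have "subdegree (fps_X * fps_exp x) = 1"
    by (rule subdegreeI) auto
  moreover have "fps_exp 1 - 1 \<noteq> (0 :: 'a fps)" "fps_X * fps_exp x \<noteq> 0"
    using nz by force+
  ultimately have "(fps_exp 1 - 1 :: 'a fps) dvd fps_X * fps_exp x"
    by (simp add: fps_dvd_iff)
  then show ?thesis
    unfolding bernoulli_egf_def by (rule dvd_div_mult_self)
qed

lemma bernoulli_umbra_eq_sum:
  assumes "degree p \<le> m"
  shows "bernoulli_umbra x p = (\<Sum>k\<le>m. coeff p k * bernoulli_poly k x)"
  unfolding bernoulli_umbra_def using assms
  by (intro sum.mono_neutral_left) (auto simp: coeff_eq_0)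

lemma bernoulli_umbra_add:
  "bernoulli_umbra x (p + q) = bernoulli_umbra x p + bernoulli_umbra x q"
proof -
  define m where "m = max (degree p) (degree q)"
  have "degree p \<le> m" "degree q \<le> m" "degree (p + q) \<le> m"
    by (auto simp: m_def degree_add_le)
  then show ?thesis
    by (simp add: bernoulli_umbra_eq_sum[of _ m] sum.distrib algebra_simps)
qed

lemma bernoulli_umbra_smult: "bernoulli_umbra x (smult c p) = c * bernoulli_umbra x p"
  by (simp add: bernoulli_umbra_eq_sum[of _ "degree p"] sum_distrib_left algebra_simps)

lemma bernoulli_umbra_diff:
  "bernoulli_umbra x (p - q) = bernoulli_umbra x p - bernoulli_umbra x q"
  using bernoulli_umbra_add[of x "p - q" q] by (simp add: algebra_simps)

lemma bernoulli_umbra_sum: "bernoulli_umbra x (\<Sum>i\<in>A. f i) = (\<Sum>i\<in>A. bernoulli_umbra x (f i))"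
  by (induction A rule: infinite_finite_induct)
     (simp_all add: bernoulli_umbra_add, simp_all add: bernoulli_umbra_def)

text \<open>The umbral form of \<open>e^(z (\<BB>(x) + c)) = e^(z \<BB>(x)) e^(z c)\<close>.\<close>

lemma bernoulli_umbra_linear_power:
  "bernoulli_umbra x ([:c, 1:] ^ k) = fact k * fps_nth (bernoulli_egf x * fps_exp c) k"
proof -
  have "bernoulli_umbra x ([:c, 1:] ^ k)
      = (\<Sum>j\<le>k. of_nat (k choose j) * c ^ (k - j) * bernoulli_poly j x)"
    using bernoulli_umbra_eq_sum[of "[:c, 1:] ^ k" k x]
    by (simp add: degree_linear_power coeff_linear_poly_power)
  also have "\<dots> = (\<Sum>j\<le>k. fact k * (fps_nth (bernoulli_egf x) j * fps_nth (fps_exp c) (k - j)))"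
    by (intro sum.cong) (auto simp: bernoulli_poly_def binomial_fact)
  also have "\<dots> = fact k * fps_nth (bernoulli_egf x * fps_exp c) k"
    by (simp add: fps_mult_nth sum_distrib_left atLeast0AtMost)
  finally show ?thesis .
qed

lemma bernoulli_umbra_difference_power:
  "bernoulli_umbra x ([:1, 1:] ^ k - [:0, 1:] ^ k) = poly (pderiv ([:0, 1:] ^ k)) x"
proof -
  have "bernoulli_umbra x ([:1, 1:] ^ k - [:0, 1:] ^ k)
      = fact k * fps_nth (bernoulli_egf x * (fps_exp 1 - 1)) k"
    by (simp add: bernoulli_umbra_diff bernoulli_umbra_linear_power algebra_simps)
  also have "\<dots> = fact k * fps_nth (fps_X * fps_exp x) k"
    by (simp only: bernoulli_egf_mult)
  also have "\<dots> = poly (pderiv ([:0, 1:] ^ k)) x"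
    by (cases k) (auto simp: pderiv_power_Suc pderiv_pCons field_simps simp del: power_Suc)
  finally show ?thesis .
qed

lemma pcompose_linear_power:
  "pcompose ([:0, 1:] ^ k) q = (q :: 'a::comm_ring_1 poly) ^ k"
  by (induction k) (simp_all add: pcompose_1 pcompose_mult pcompose_pCons del: mult_pCons_left)

lemma pderiv_sum: "pderiv (\<Sum>i\<in>A. f i) = (\<Sum>i\<in>A. pderiv (f i))"
  by (induction A rule: infinite_finite_induct) (simp_all add: pderiv_add)

lemma bernoulli_umbra_difference:
  "bernoulli_umbra x (pcompose p [:1, 1:] - p) = poly (pderiv p) x"
proof -
  have p: "p = (\<Sum>k\<le>degree p. smult (coeff p k) ([:0, 1:] ^ k))"
    using poly_as_sum_of_monoms[of p] by (simp add: monom_altdef)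
  have "pcompose p [:1, 1:] = (\<Sum>k\<le>degree p. smult (coeff p k) ([:1, 1:] ^ k))"
    by (subst p) (simp add: pcompose_sum pcompose_smult pcompose_linear_power)
  then have "pcompose p [:1, 1:] - p
      = (\<Sum>k\<le>degree p. smult (coeff p k) ([:1, 1:] ^ k - [:0, 1:] ^ k))"
    using p by (simp add: sum_subtractf smult_diff_right)
  then have "bernoulli_umbra x (pcompose p [:1, 1:] - p)
      = (\<Sum>k\<le>degree p. coeff p k * poly (pderiv ([:0, 1:] ^ k)) x)"
    by (simp only: bernoulli_umbra_sum bernoulli_umbra_smult bernoulli_umbra_difference_power)
  also have "\<dots> = poly (pderiv (\<Sum>k\<le>degree p. smult (coeff p k) ([:0, 1:] ^ k))) x"
    by (simp add: pderiv_sum pderiv_smult poly_sum)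
  finally show ?thesis
    using p by simp
qed

lemma poly_pochhammer: "poly (pochhammer p n) x = pochhammer (poly p x) n"
  by (simp add: pochhammer_prod poly_prod)

lemma pcompose_pochhammer_linear:
  fixes c :: "'a::field_char_0"
  shows "pcompose (pochhammer [:c, 1:] n) [:1, 1:] = pochhammer [:c + 1, 1:] n"
  by (simp add: pochhammer_prod pcompose_prod pcompose_pCons pcompose_add of_nat_poly
      algebra_simps)

lemma bernoulli_umbra_pochhammer:
  "bernoulli_umbra x (pochhammer [:c, 1:] n)
     = poly (pderiv (pochhammer [:c - 1, 1:] (Suc n))) x / of_nat (Suc n)"
proof -
  let ?p = "pochhammer [:c - 1, 1:] (Suc n)"
  have "pcompose ?p [:1, 1:] - ?p
      = pochhammer [:c, 1:] (Suc n) - [:c - 1, 1:] * pochhammer ([:c - 1, 1:] + 1) n"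
    by (simp only: pcompose_pochhammer_linear diff_add_cancel)
       (simp only: pochhammer_rec[of "[:c - 1, 1:]"])
  also have "[:c - 1, 1:] + 1 = [:c, 1:]"
    by (simp add: one_pCons)
  also have "pochhammer [:c, 1:] (Suc n) - [:c - 1, 1:] * pochhammer [:c, 1:] n
      = ([:c, 1:] + of_nat n - [:c - 1, 1:]) * pochhammer [:c, 1:] n"
    by (simp only: pochhammer_Suc algebra_simps)
  also have "[:c, 1:] + of_nat n - [:c - 1, 1:] = [:of_nat (Suc n):]"
    by (simp add: of_nat_poly)
  finally have "pcompose ?p [:1, 1:] - ?p = smult (of_nat (Suc n)) (pochhammer [:c, 1:] n)"
    by simp
  then have "of_nat (Suc n) * bernoulli_umbra x (pochhammer [:c, 1:] n) = poly (pderiv ?p) x"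
    using bernoulli_umbra_difference[of x ?p] by (simp only: bernoulli_umbra_smult)
  then show ?thesis
    by (simp add: nonzero_eq_divide_eq mult.commute del: of_nat_Suc)
qed

text \<open>
  The point \<open>1 - c\<close> is the root of the first factor of \<open>(u + c - 1)\<^sub>n\<^sub>+\<^sub>1\<close>, so the derivative there
  is the value \<open>(1)\<^sub>n\<close> of the remaining factors.
\<close>

lemma bernoulli_umbra_pochhammer_at_root:
  "bernoulli_umbra (1 - c) (pochhammer [:c, 1:] n) = fact n / of_nat (Suc n)"
proof -
  have "[:c - 1, 1:] + 1 = [:c, 1:]"
    by (simp add: one_pCons)
  then have "pochhammer [:c - 1, 1:] (Suc n) = [:c - 1, 1:] * pochhammer [:c, 1:] n"
    by (simp only: pochhammer_rec)
  then have "poly (pderiv (pochhammer [:c - 1, 1:] (Suc n))) (1 - c) = fact n"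
    by (simp add: pderiv_mult pderiv_pCons poly_pochhammer pochhammer_fact
        del: mult_pCons_left)
  then show ?thesis
    by (simp only: bernoulli_umbra_pochhammer)
qed

lemma poly_pderiv_pochhammer_Digamma:
  fixes x c :: complex
  assumes "x + c \<notin> \<int>\<^sub>\<le>\<^sub>0"
  shows "poly (pderiv (pochhammer [:c, 1:] m)) x
           = pochhammer (x + c) m * (Digamma (x + c + of_nat m) - Digamma (x + c))"
proof (induction m)
  case 0
  show ?case by simp
next
  case (Suc m)
  have nz: "x + c + of_nat m \<noteq> 0"
    using assms plus_of_nat_eq_0_imp by blast
  have "poly (pderiv (pochhammer [:c, 1:] (Suc m))) x
      = pochhammer (x + c) m * (Digamma (x + c + of_nat m) - Digamma (x + c)) * (x + c + of_nat m)
        + pochhammer (x + c) m"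
    by (simp add: pochhammer_Suc pderiv_mult pderiv_add pderiv_pCons poly_pochhammer of_nat_poly
        Suc.IH add_ac mult_ac del: mult_pCons_left mult_pCons_right)
  also have "\<dots> = pochhammer (x + c) (Suc m)
      * (Digamma (x + c + of_nat m) + 1 / (x + c + of_nat m) - Digamma (x + c))"
    using nz by (simp add: pochhammer_Suc field_simps)
  also have "Digamma (x + c + of_nat m) + 1 / (x + c + of_nat m)
      = Digamma (x + c + of_nat (Suc m))"
    using Digamma_plus1[OF nz] by (simp add: ac_simps)
  finally show ?case .
qed

lemma Digamma_difference_eq_pderiv:
  fixes x :: complex
  assumes "x - 1 \<notin> \<int>\<^sub>\<le>\<^sub>0"
  shows "pochhammer (x - 1) (n + 1) / of_nat (n + 1) *
           (Digamma (x + of_nat n) - Digamma (x - 1))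
         = poly (pderiv (pochhammer [:-1, 1:] (Suc n))) x / of_nat (Suc n)"
  using poly_pderiv_pochhammer_Digamma[of x "-1" "Suc n"] assms by simp

theorem mainTheorem7:
  fixes n :: nat
  shows "(\<forall>x::complex. x - 1 \<notin> \<int>\<^sub>\<le>\<^sub>0 \<longrightarrow>
            bernoulli_umbra x (pochhammer [:0, 1:] n) =
              pochhammer (x - 1) (n + 1) / of_nat (n + 1) *
                (Digamma (x + of_nat n) - Digamma (x - 1))) \<and>
         ((\<lambda>x::complex. pochhammer (x - 1) (n + 1) / of_nat (n + 1) *
             (Digamma (x + of_nat n) - Digamma (x - 1)))
            \<longlongrightarrow> fact n / of_nat (n + 1)) (at 1) \<and>
         bernoulli_umbra (1::complex) (pochhammer [:0, 1:] n) = fact n / of_nat (n + 1) \<and>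
         bernoulli_umbra (0::complex) (pochhammer [:1, 1:] n) = fact n / of_nat (n + 1)"
proof -
  let ?f = "\<lambda>x::complex. pochhammer (x - 1) (n + 1) / of_nat (n + 1) *
              (Digamma (x + of_nat n) - Digamma (x - 1))"
  let ?g = "\<lambda>x::complex. poly (pderiv (pochhammer [:-1, 1:] (Suc n))) x / of_nat (Suc n)"
  have umbra: "bernoulli_umbra x (pochhammer [:0, 1:] n) = ?g x" for x :: complex
    using bernoulli_umbra_pochhammer[of x 0 n] by simp
  have fg: "?f x = ?g x" if "x - 1 \<notin> \<int>\<^sub>\<le>\<^sub>0" for x
    using that by (rule Digamma_difference_eq_pderiv)
  have one: "bernoulli_umbra (1::complex) (pochhammer [:0, 1:] n) = fact n / of_nat (n + 1)"
    using bernoulli_umbra_pochhammer_at_root[of "0::complex" n] by simp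
  have zero: "bernoulli_umbra (0::complex) (pochhammer [:1, 1:] n) = fact n / of_nat (n + 1)"
    using bernoulli_umbra_pochhammer_at_root[of "1::complex" n] by simp
  have "\<forall>\<^sub>F x in at (1::complex). ?f x = ?g x"
  proof -
    \<comment> \<open>The poles of \<open>\<psi>(x - 1)\<close> are integers, so the unit disc around 1 meets them only in 1.\<close>
    have "x - 1 \<notin> \<int>\<^sub>\<le>\<^sub>0" if "x \<noteq> 1" "dist x 1 < 1" for x :: complex
    proof
      assume "x - 1 \<in> \<int>\<^sub>\<le>\<^sub>0"
      then obtain k where k: "x - 1 = - of_nat k"
        by (elim nonpos_Ints_cases')
      then have "real k < 1"
        using that(2) by (simp add: dist_norm)
      then show False
        using k that(1) by simp
    qed
    then show ?thesis
      using fg unfolding eventually_at by (intro exI[of _ 1]) auto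
  qed
  moreover have "(?g \<longlongrightarrow> ?g 1) (at 1)"
    by (intro tendsto_intros) (simp del: of_nat_Suc)
  ultimately have "(?f \<longlongrightarrow> ?g 1) (at 1)"
    by (simp only: tendsto_cong)
  then have lim: "(?f \<longlongrightarrow> fact n / of_nat (n + 1)) (at 1)"
    by (simp only: umbra[symmetric] one)
  have formula: "bernoulli_umbra x (pochhammer [:0, 1:] n) = ?f x" if "x - 1 \<notin> \<int>\<^sub>\<le>\<^sub>0" for x
    using umbra fg[OF that] by (simp only:)
  show ?thesis
    using formula lim one zero by blast
qed

end
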